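(* Let $j_n\in[n]$ and $t_n\in\mathbb{N}$ be sequences. Assume that $\gamma=\lim_{n\to\infty}j_n/n$ exists and that $$\lim_{n\to\infty}\frac{n^2}{t_n j_n(n-j_n)}=\lim_{n\to\infty}\frac{t_n}{j_n(n-j_n)}=0.$$ Then $$\mathbb{P}^n_{id}\left(\left.\frac{\Pi_{t_n}(j_n)-j_n}{\sqrt{2t_n\lambda_n}}\in\cdot\,\right|\,j_n\in A^{t_n}\right)\Longrightarrow \mathbb{P}(N(0,1)\in\cdot),$$ where $\lambda_n=j_n/n$ if $\gamma=0$, $\lambda_n=(n-j_n)/n$ if $\gamma=1$, and $\lambda_n=\gamma(1-\gamma)$ if $\gamma\in(0,1)$.
   Context: The random-to-random insertions shuffle on a deck of $n$ cards numbered $1,\dots,n$: at each step a card is chosen uniformly at random, removed, and reinserted at a uniformly random position. Orderings are identified with $\sigma\in S_n$, $\sigma(j)$ being the position of card $j$; $\Pi_t$ is the induced random walk on $S_n$ and $\mathbb{P}^n_{id}$ its law started at the identity, so $\Pi_t(j)$ is the position of card $j$ after $t$ shuffles. $A^t=A^{n,t}$ denotes the (random) set of cards that have not been chosen for removal in the first $t$ shuffles. $[n]=\{1,\dots,n\}$, $\Rightarrow$ denotes weak convergence and $N(0,1)$ a standard normal random variable. *)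

theory Defs
  imports "HOL-Probability.Probability"
begin

text \<open>A deck ordering is a function sigma with sigma j = position of card j
  (a permutation of {1..n}, identity outside). Removing card c (at position sigma c)
  and reinserting it at position p:\<close>
definition insert_move :: "nat \<Rightarrow> nat \<Rightarrow> (nat \<Rightarrow> nat) \<Rightarrow> (nat \<Rightarrow> nat)" where
  "insert_move c p \<sigma> = (\<lambda>k. if k = c then p
      else if \<sigma> c < \<sigma> k \<and> \<sigma> k \<le> p then \<sigma> k - 1
      else if p \<le> \<sigma> k \<and> \<sigma> k < \<sigma> c then \<sigma> k + 1
      else \<sigma> k)"

text \<open>One random-to-random step on the state (ordering, set of cards not yet removed).\<close>
definition rtr_step :: "nat \<Rightarrow> (nat \<Rightarrow> nat) \<times> nat set \<Rightarrow> ((nat \<Rightarrow> nat) \<times> nat set) pmf" where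
  "rtr_step n s = bind_pmf (pmf_of_set {1..n}) (\<lambda>c.
      bind_pmf (pmf_of_set {1..n}) (\<lambda>p.
        return_pmf (insert_move c p (fst s), snd s - {c})))"

fun rtr :: "nat \<Rightarrow> nat \<Rightarrow> ((nat \<Rightarrow> nat) \<times> nat set) pmf" where
  "rtr n 0 = return_pmf (id, {1..n})"
| "rtr n (Suc t) = bind_pmf (rtr n t) (rtr_step n)"

end

theory Submission
  imports Defs "HOL-Real_Asymp.Real_Asymp"
begin

text \<open>
  Given that card \<open>j\<close> has not been chosen, its position is a Markov chain on \<open>{1..n}\<close> that jumps up from
  \<open>x\<close> at rate \<open>p x = x (n - x) / (n (n - 1))\<close> and down at rate \<open>p (x - 1)\<close>; this chain is symmetric up to
  a drift of size at most \<open>1 / n\<close>. A second moment computation shows that up to time \<open>t\<close> it stays so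
  close to \<open>j\<close> that \<open>p\<close> is nearly constant, equal to \<open>\<lambda>\<close>. Hence, with \<open>a = u / sqrt (2 t \<lambda>)\<close>, each step
  multiplies the characteristic function by \<open>exp (- \<lambda> a\<^sup>2)\<close> up to an error \<open>o(1/t)\<close>, so that after \<open>t\<close> steps
  it is \<open>exp (- u\<^sup>2 / 2) + o(1)\<close>, and Levy's continuity theorem applies.
\<close>

section \<open>Transition operator and conditional law of the position of a card that is not
  chosen\<close>

definition up_rate :: "nat \<Rightarrow> nat \<Rightarrow> real" where
  "up_rate n x = real x * (real n - real x) / (real n * (real n - 1))"

definition down_rate :: "nat \<Rightarrow> nat \<Rightarrow> real" where
  "down_rate n x = (real x - 1) * (real n - real x + 1) / (real n * (real n - 1))"

text \<open>Values in a real vector space let one operator serve both real moments and complex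
  characteristic functions. The truncated \<open>x - 1\<close> at \<open>x = 1\<close> and the
  argument \<open>n + 1\<close> at \<open>x = n\<close> do no harm, because
  \<open>down_rate n 1 = 0\<close> and \<open>up_rate n n = 0\<close>.\<close>

definition pos_op :: "nat \<Rightarrow> (nat \<Rightarrow> 'a::real_vector) \<Rightarrow> nat \<Rightarrow> 'a" where
  "pos_op n g x = up_rate n x *\<^sub>R g (x + 1) + down_rate n x *\<^sub>R g (x - 1)
     + (1 - up_rate n x - down_rate n x) *\<^sub>R g x"

text \<open>The conditioning event concerns the first \<open>k\<close> shuffles only, so it changes
  with \<open>k\<close>. That these laws still evolve by one fixed operator is the content of
  \<open>expectation_pos_law_Suc\<close>.\<close>

definition pos_law :: "nat \<Rightarrow> nat \<Rightarrow> nat \<Rightarrow> nat pmf" where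
  "pos_law n j k = map_pmf (\<lambda>(\<sigma>, A). \<sigma> j) (cond_pmf (rtr n k) {(\<sigma>, A). j \<in> A})"

section \<open>States that the shuffle can reach\<close>

lemma insert_move_bij_betw:
  assumes "bij_betw \<sigma> {1..n} {1..n}" "c \<in> {1..n}" "p \<in> {1..n}"
  shows "bij_betw (insert_move c p \<sigma>) {1..n} {1..n}"
proof -
  have inj: "\<sigma> k = \<sigma> l \<longleftrightarrow> k = l" if "k \<in> {1..n}" "l \<in> {1..n}" for k l
    using assms(1) that by (meson bij_betw_imp_inj_on inj_on_eq_iff)
  have range: "1 \<le> \<sigma> k \<and> \<sigma> k \<le> n" if "k \<in> {1..n}" for k
    using bij_betwE[OF assms(1)] that by auto
  have "inj_on (insert_move c p \<sigma>) {1..n}"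
  proof (rule inj_onI)
    fix k l assume kl: "k \<in> {1..n}" "l \<in> {1..n}" "insert_move c p \<sigma> k = insert_move c p \<sigma> l"
    show "k = l"
      using kl(3) inj[OF kl(1,2)] inj[OF kl(1) assms(2)] inj[OF kl(2) assms(2)]
      unfolding insert_move_def by (auto split: if_splits)
  qed
  moreover have "insert_move c p \<sigma> ` {1..n} \<subseteq> {1..n}"
  proof
    fix y assume "y \<in> insert_move c p \<sigma> ` {1..n}"
    then obtain k where k: "k \<in> {1..n}" "y = insert_move c p \<sigma> k" by auto
    show "y \<in> {1..n}"
      using k(2) range[OF k(1)] range[OF assms(2)] assms(3)
      unfolding insert_move_def by (auto split: if_splits)
  qed
  ultimately show ?thesis
    by (simp add: bij_betw_def endo_inj_surj)
qed

lemma set_rtr_step: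
  assumes "n \<ge> 1"
  shows "set_pmf (rtr_step n s) = (\<lambda>(c, p). (insert_move c p (fst s), snd s - {c})) ` ({1..n} \<times> {1..n})"
  unfolding rtr_step_def using assms by (auto simp: set_pmf_of_set image_def)

lemma finite_set_rtr [simp]: "n \<ge> 1 \<Longrightarrow> finite (set_pmf (rtr n k))"
  by (induction k) (auto simp: set_rtr_step)

lemma rtr_bij_betw:
  assumes "n \<ge> 1" "s \<in> set_pmf (rtr n k)"
  shows "bij_betw (fst s) {1..n} {1..n}"
  using assms(2)
proof (induction k arbitrary: s)
  case (Suc k)
  then obtain r c p where "r \<in> set_pmf (rtr n k)" "c \<in> {1..n}" "p \<in> {1..n}"
      "fst s = insert_move c p (fst r)"
    using assms(1) by (auto simp: set_rtr_step)
  with Suc.IH show ?case by (simp only: insert_move_bij_betw)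
qed simp

text \<open>Guarantees that the conditioning event has positive mass, which every use of
  \<open>cond_pmf\<close> requires. At each step some card other than \<open>j\<close> may be
  removed.\<close>

lemma rtr_not_chosen_possible:
  assumes "n \<ge> 2" "j \<in> {1..n}"
  shows "set_pmf (rtr n k) \<inter> {(\<sigma>, A). j \<in> A} \<noteq> {}"
proof (induction k)
  case 0
  then show ?case using assms by auto
next
  case (Suc k)
  then obtain s where s: "s \<in> set_pmf (rtr n k)" "j \<in> snd s" by auto
  \<comment> \<open>Any card except \<open>j\<close> would do; \<open>n >= 2\<close> provides card 2
    when \<open>j\<close> is 1.\<close>
  define c where "c = (if j = 1 then 2 else 1 :: nat)"
  have c: "c \<in> {1..n}" "c \<noteq> j" using assms by (auto simp: c_def)
  have "(insert_move c 1 (fst s), snd s - {c}) \<in> set_pmf (rtr_step n s)"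
    using assms c by (auto simp: set_rtr_step)
  then have "(insert_move c 1 (fst s), snd s - {c}) \<in> set_pmf (rtr n (Suc k))"
    using s by auto
  then show ?case using s(2) c(2) by auto
qed

section \<open>One shuffle as seen from a single card\<close>

lemma sum_insert_move_position:
  fixes g :: "nat \<Rightarrow> 'a::real_vector"
  assumes "n \<ge> 2" "bij_betw \<sigma> {1..n} {1..n}" "j \<in> {1..n}"
  shows "(\<Sum>c\<in>{1..n} - {j}. \<Sum>p\<in>{1..n}. g (insert_move c p \<sigma> j))
    = (real n * (real n - 1)) *\<^sub>R pos_op n g (\<sigma> j)"
proof -
  define x where "x = \<sigma> j"
  have x: "1 \<le> x" "x \<le> n" using bij_betwE[OF assms(2)] assms(3) by (auto simp: x_def)
  \<comment> \<open>The move of card \<open>j\<close> depends only on the position \<open>r\<close>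
    of the removed card and on \<open>p\<close>. If \<open>r < x\<close>, the
    \<open>n - x + 1\<close> values \<open>p >= x\<close> push it down; if \<open>r > x\<close>, the
    \<open>x\<close> values \<open>p <= x\<close> push it up. In both cases \<open>p = x\<close>
    counts as a push.\<close>
  define h where "h r = (\<Sum>p\<in>{1..n}. g (if r < x \<and> x \<le> p then x - 1
      else if p \<le> x \<and> x < r then x + 1 else x))" for r
  have below: "h r = (real n - real x + 1) *\<^sub>R g (x - 1) + (real x - 1) *\<^sub>R g x" if "r < x" for r
  proof -
    have split: "{1..n} = {x..n} \<union> {1..<x}" using x by auto
    have "h r = (\<Sum>p\<in>{x..n}. g (x - 1)) + (\<Sum>p\<in>{1..<x}. g x)"
      unfolding h_def split using that
      by (subst sum.union_disjoint) (auto intro!: arg_cong2[where f="(+)"] sum.cong)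
    then show ?thesis using x by (simp add: sum_constant_scaleR of_nat_diff)
  qed
  have above: "h r = real x *\<^sub>R g (x + 1) + (real n - real x) *\<^sub>R g x" if "r > x" for r
  proof -
    have split: "{1..n} = {1..x} \<union> {Suc x..n}" using x by auto
    have "h r = (\<Sum>p\<in>{1..x}. g (x + 1)) + (\<Sum>p\<in>{Suc x..n}. g x)"
      unfolding h_def split using that
      by (subst sum.union_disjoint) (auto intro!: arg_cong2[where f="(+)"] sum.cong)
    then show ?thesis using x by (simp add: sum_constant_scaleR of_nat_diff)
  qed
  \<comment> \<open>As the removed card varies, \<open>r\<close> takes each value other than
    \<open>x\<close> exactly once: \<open>x - 1\<close> of them lie below \<open>x\<close> and
    \<open>n - x\<close> above.\<close>
  have "bij_betw \<sigma> ({1..n} - {j}) ({1..n} - {x})"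
    unfolding x_def using assms by (intro bij_betw_DiffI) (auto simp: bij_betw_def)
  then have "(\<Sum>c\<in>{1..n} - {j}. h (\<sigma> c)) = (\<Sum>r\<in>{1..n} - {x}. h r)"
    by (rule sum.reindex_bij_betw)
  also have "{1..n} - {x} = {1..<x} \<union> {Suc x..n}" using x by auto
  also have "(\<Sum>r\<in>{1..<x} \<union> {Suc x..n}. h r) = (\<Sum>r\<in>{1..<x}. h r) + (\<Sum>r\<in>{Suc x..n}. h r)"
    by (rule sum.union_disjoint) auto
  also have "(\<Sum>r\<in>{1..<x}. h r)
      = (real x - 1) *\<^sub>R ((real n - real x + 1) *\<^sub>R g (x - 1) + (real x - 1) *\<^sub>R g x)"
    using x by (simp add: below sum_constant_scaleR of_nat_diff)
  also have "(\<Sum>r\<in>{Suc x..n}. h r)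
      = (real n - real x) *\<^sub>R (real x *\<^sub>R g (x + 1) + (real n - real x) *\<^sub>R g x)"
    using x by (simp add: above sum_constant_scaleR of_nat_diff)
  finally have sum_h: "(\<Sum>c\<in>{1..n} - {j}. h (\<sigma> c)) =
     ((real n - real x) * real x) *\<^sub>R g (x + 1) + ((real x - 1) * (real n - real x + 1)) *\<^sub>R g (x - 1)
     + ((real x - 1) * (real x - 1) + (real n - real x) * (real n - real x)) *\<^sub>R g x"
    unfolding scaleR_left_distrib[of "(real x - 1) * (real x - 1)"]
    by (simp only: scaleR_add_right scaleR_scaleR ac_simps)
  have "(\<Sum>c\<in>{1..n} - {j}. \<Sum>p\<in>{1..n}. g (insert_move c p \<sigma> j)) = (\<Sum>c\<in>{1..n} - {j}. h (\<sigma> c))"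
    unfolding h_def by (intro sum.cong refl arg_cong[where f=g]) (auto simp: insert_move_def x_def)
  moreover have "(real n * (real n - 1)) *\<^sub>R pos_op n g x =
     ((real n - real x) * real x) *\<^sub>R g (x + 1) + ((real x - 1) * (real n - real x + 1)) *\<^sub>R g (x - 1)
     + ((real x - 1) * (real x - 1) + (real n - real x) * (real n - real x)) *\<^sub>R g x"
  proof -
    \<comment> \<open>Multiplication by \<open>N\<close> turns the rates into polynomials, so the
      coefficients can be compared by ring arithmetic.\<close>
    define N where "N = real n * (real n - 1)"
    have N: "N \<noteq> 0" using assms(1) by (auto simp: N_def)
    have "N * up_rate n x = (real n - real x) * real x"
      "N * down_rate n x = (real x - 1) * (real n - real x + 1)"
      unfolding up_rate_def down_rate_def N_def[symmetric] using N by simp_all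
    moreover from this have "N * (1 - up_rate n x - down_rate n x)
       = (real x - 1) * (real x - 1) + (real n - real x) * (real n - real x)"
      by (simp add: N_def algebra_simps)
    ultimately show ?thesis
      unfolding pos_op_def N_def[symmetric] by (simp add: scaleR_add_right)
  qed
  ultimately show ?thesis using sum_h by (simp add: x_def)
qed

text \<open>Keeping the survival indicator inside the expectation postpones the conditioning. Pairs
  with \<open>c = j\<close> contribute nothing; the other \<open>n * (n - 1)\<close> of the
  \<open>n * n\<close> pairs give the survival probability \<open>(n - 1) / n\<close>, the same for
  every ordering, times their average.\<close>

lemma expectation_rtr_step:
  fixes g :: "nat \<Rightarrow> 'a::{banach, second_countable_topology}"
  assumes "n \<ge> 2" "bij_betw \<sigma> {1..n} {1..n}" "j \<in> {1..n}"
  shows "measure_pmf.expectation (rtr_step n (\<sigma>, A)) (\<lambda>(\<tau>, B). if j \<in> B then g (\<tau> j) else 0)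
    = (if j \<in> A then ((real n - 1) / real n) *\<^sub>R pos_op n g (\<sigma> j) else 0)"
proof -
  have ne: "{1..n} \<noteq> {}" using assms by auto
  have "measure_pmf.expectation (rtr_step n (\<sigma>, A)) (\<lambda>(\<tau>, B). if j \<in> B then g (\<tau> j) else 0)
    = (\<Sum>c\<in>{1..n}. \<Sum>p\<in>{1..n}. (if j \<in> A - {c} then g (insert_move c p \<sigma> j) else 0) /\<^sub>R real n /\<^sub>R real n)"
    unfolding rtr_step_def using ne
    by (subst pmf_expectation_bind_pmf_of_set)
       (auto simp: pmf_expectation_bind_pmf_of_set scaleR_sum_right set_pmf_of_set intro!: sum.cong)
  also have "\<dots> = (\<Sum>c\<in>{1..n} - {j}. \<Sum>p\<in>{1..n}. (if j \<in> A - {c} then g (insert_move c p \<sigma> j) else 0) /\<^sub>R real n /\<^sub>R real n)"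
    by (rule sum.mono_neutral_right) auto
  also have "\<dots> = (if j \<in> A then (1 / (real n * real n)) *\<^sub>R (\<Sum>c\<in>{1..n} - {j}. \<Sum>p\<in>{1..n}. g (insert_move c p \<sigma> j)) else 0)"
    by (auto simp: scaleR_sum_right divide_inverse intro!: sum.cong)
  also have "\<dots> = (if j \<in> A then ((real n - 1) / real n) *\<^sub>R pos_op n g (\<sigma> j) else 0)"
    using assms by (subst sum_insert_move_position) auto
  finally show ?thesis .
qed

section \<open>Conditioning on the card not being chosen\<close>

lemma expectation_cond_pmf_finite:
  fixes f :: "'b \<Rightarrow> 'a::{banach, second_countable_topology}"
  assumes "finite (set_pmf p)" "set_pmf p \<inter> S \<noteq> {}"
  shows "measure_pmf.expectation p (\<lambda>x. if x \<in> S then f x else 0)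
     = measure_pmf.prob p S *\<^sub>R measure_pmf.expectation (cond_pmf p S) f"
proof -
  have pos: "measure_pmf.prob p S \<noteq> 0"
    using assms(2) measure_pmf_posI by (metis disjoint_iff less_irrefl)
  have "measure_pmf.expectation (cond_pmf p S) f = (\<Sum>x\<in>set_pmf p. pmf (cond_pmf p S) x *\<^sub>R f x)"
    using assms by (intro integral_measure_pmf) auto
  also have "measure_pmf.prob p S *\<^sub>R \<dots> = (\<Sum>x\<in>set_pmf p. pmf p x *\<^sub>R (if x \<in> S then f x else 0))"
    unfolding scaleR_sum_right using assms pos by (intro sum.cong) (auto simp: pmf_cond)
  also have "\<dots> = measure_pmf.expectation p (\<lambda>x. if x \<in> S then f x else 0)"
    using assms by (intro integral_measure_pmf[symmetric]) auto
  finally show ?thesis by simp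
qed

lemma expectation_pos_law:
  fixes g :: "nat \<Rightarrow> 'a::{banach, second_countable_topology}"
  assumes "n \<ge> 2" "j \<in> {1..n}"
  shows "measure_pmf.expectation (rtr n k) (\<lambda>(\<sigma>, A). if j \<in> A then g (\<sigma> j) else 0)
     = measure_pmf.prob (rtr n k) {(\<sigma>, A). j \<in> A} *\<^sub>R measure_pmf.expectation (pos_law n j k) g"
proof -
  have "measure_pmf.expectation (rtr n k) (\<lambda>(\<sigma>, A). if j \<in> A then g (\<sigma> j) else 0)
    = measure_pmf.expectation (rtr n k) (\<lambda>s. if s \<in> {(\<sigma>, A). j \<in> A} then (\<lambda>(\<sigma>, A). g (\<sigma> j)) s else 0)"
    by (intro arg_cong[where f="measure_pmf.expectation _"]) (auto simp: fun_eq_iff)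
  also have "\<dots> = measure_pmf.prob (rtr n k) {(\<sigma>, A). j \<in> A} *\<^sub>R
      measure_pmf.expectation (cond_pmf (rtr n k) {(\<sigma>, A). j \<in> A}) (\<lambda>(\<sigma>, A). g (\<sigma> j))"
    using assms rtr_not_chosen_possible[OF assms]
    by (intro expectation_cond_pmf_finite) auto
  also have "measure_pmf.expectation (cond_pmf (rtr n k) {(\<sigma>, A). j \<in> A}) (\<lambda>(\<sigma>, A). g (\<sigma> j))
      = measure_pmf.expectation (pos_law n j k) g"
    by (simp add: pos_law_def case_prod_unfold)
  finally show ?thesis .
qed

text \<open>The finite support makes every function integrable and lets later pointwise estimates be
  restricted to \<open>{1..n}\<close>.\<close>

lemma set_pos_law:
  assumes "n \<ge> 2" "j \<in> {1..n}"
  shows "set_pmf (pos_law n j k) \<subseteq> {1..n}"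
proof
  fix x assume "x \<in> set_pmf (pos_law n j k)"
  then obtain s where "s \<in> set_pmf (rtr n k)" "x = fst s j"
    unfolding pos_law_def set_map_pmf set_cond_pmf[OF rtr_not_chosen_possible[OF assms]]
    by (auto simp: case_prod_unfold)
  then show "x \<in> {1..n}"
    using rtr_bij_betw[of n s k] assms bij_betwE by fastforce
qed

lemma integrable_pos_law:
  fixes g :: "nat \<Rightarrow> 'a::{banach, second_countable_topology}"
  assumes "n \<ge> 2" "j \<in> {1..n}"
  shows "integrable (measure_pmf (pos_law n j k)) g"
  using set_pos_law[OF assms] finite_subset by (intro integrable_measure_pmf_finite) blast

lemma pos_law_0:
  assumes "n \<ge> 2" "j \<in> {1..n}"
  shows "pos_law n j 0 = return_pmf j"
proof -
  have "set_pmf (pos_law n j 0) = {j}"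
    using rtr_not_chosen_possible[OF assms, of 0] by (auto simp: pos_law_def)
  then show ?thesis by (metis set_pmf_subset_singleton subset_refl)
qed

text \<open>The chance of surviving one more step does not depend on the position. Hence the
  unnormalised expectations and the survival probability pick up the same factor
  \<open>(n - 1) / n\<close>, which cancels in the conditional law.\<close>

lemma expectation_pos_law_Suc:
  fixes g :: "nat \<Rightarrow> 'a::{banach, second_countable_topology}"
  assumes "n \<ge> 2" "j \<in> {1..n}"
  shows "measure_pmf.expectation (pos_law n j (Suc k)) g
     = measure_pmf.expectation (pos_law n j k) (pos_op n g)"
proof -
  define P where "P k = measure_pmf.prob (rtr n k) {(\<sigma>, A). j \<in> A}" for k
  \<comment> \<open>The function \<open>f\<close> has a value type of its own, because
    \<open>step\<close> is applied both to the real constant 1 and to \<open>g\<close>.\<close>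
  have step: "P (Suc k) *\<^sub>R measure_pmf.expectation (pos_law n j (Suc k)) f
     = ((real n - 1) / real n) *\<^sub>R P k *\<^sub>R measure_pmf.expectation (pos_law n j k) (pos_op n f)"
    for f :: "nat \<Rightarrow> 'c::{banach, second_countable_topology}"
  proof -
    have "P (Suc k) *\<^sub>R measure_pmf.expectation (pos_law n j (Suc k)) f
      = measure_pmf.expectation (rtr n k \<bind> rtr_step n) (\<lambda>(\<sigma>, A). if j \<in> A then f (\<sigma> j) else 0)"
      using expectation_pos_law[OF assms, of "Suc k" f] by (simp add: P_def)
    also have "\<dots> = (\<Sum>s\<in>set_pmf (rtr n k). pmf (rtr n k) s *\<^sub>R
         measure_pmf.expectation (rtr_step n s) (\<lambda>(\<sigma>, A). if j \<in> A then f (\<sigma> j) else 0))"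
      using assms by (intro pmf_expectation_bind) (auto simp: set_rtr_step)
    also have "\<dots> = (\<Sum>s\<in>set_pmf (rtr n k). pmf (rtr n k) s *\<^sub>R ((real n - 1) / real n) *\<^sub>R
         (\<lambda>(\<sigma>, A). if j \<in> A then pos_op n f (\<sigma> j) else 0) s)"
    proof (rule sum.cong[OF refl])
      fix s assume "s \<in> set_pmf (rtr n k)"
      then show "pmf (rtr n k) s *\<^sub>R
         measure_pmf.expectation (rtr_step n s) (\<lambda>(\<sigma>, A). if j \<in> A then f (\<sigma> j) else 0)
         = pmf (rtr n k) s *\<^sub>R ((real n - 1) / real n) *\<^sub>R
         (\<lambda>(\<sigma>, A). if j \<in> A then pos_op n f (\<sigma> j) else 0) s"
        using expectation_rtr_step[OF assms(1) rtr_bij_betw assms(2), of s k "snd s" f] assms(1)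
        by (simp add: case_prod_unfold)
    qed
    also have "\<dots> = ((real n - 1) / real n) *\<^sub>R (\<Sum>s\<in>set_pmf (rtr n k). pmf (rtr n k) s *\<^sub>R
         (\<lambda>(\<sigma>, A). if j \<in> A then pos_op n f (\<sigma> j) else 0) s)"
      unfolding scaleR_sum_right by (intro sum.cong refl) (rule scaleR_left_commute)
    also have "(\<Sum>s\<in>set_pmf (rtr n k). pmf (rtr n k) s *\<^sub>R
         (\<lambda>(\<sigma>, A). if j \<in> A then pos_op n f (\<sigma> j) else 0) s)
      = measure_pmf.expectation (rtr n k) (\<lambda>(\<sigma>, A). if j \<in> A then pos_op n f (\<sigma> j) else 0)"
      using assms by (intro integral_measure_pmf[symmetric]) auto
    also have "\<dots> = P k *\<^sub>R measure_pmf.expectation (pos_law n j k) (pos_op n f)"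
      unfolding P_def by (rule expectation_pos_law[OF assms])
    finally show ?thesis .
  qed
  \<comment> \<open>Since \<open>pos_op\<close> fixes constants, \<open>step\<close> at the constant
    1 is the recursion for the survival probability.\<close>
  have "pos_op n (\<lambda>_. 1 :: real) = (\<lambda>_. 1)"
    by (simp add: pos_op_def fun_eq_iff)
  then have "P (Suc k) = ((real n - 1) / real n) * P k"
    using step[of "\<lambda>_. 1 :: real"] by simp
  moreover have "P (Suc k) \<noteq> 0"
    unfolding P_def using rtr_not_chosen_possible[OF assms, of "Suc k"] measure_pmf_posI
    by (metis disjoint_iff less_irrefl)
  ultimately show ?thesis using step[of g]
    by (metis (no_types, lifting) scaleR_scaleR scaleR_cancel_left)
qed

lemma expectation_pos_law_mono:
  fixes f g :: "nat \<Rightarrow> real"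
  assumes "n \<ge> 2" "j \<in> {1..n}" "\<And>x. x \<in> {1..n} \<Longrightarrow> f x \<le> g x"
  shows "measure_pmf.expectation (pos_law n j k) f \<le> measure_pmf.expectation (pos_law n j k) g"
  using set_pos_law[OF assms(1,2), of k] assms(3)
  by (intro integral_mono_AE integrable_pos_law assms AE_pmfI) blast+

lemma expectation_pos_law_cong:
  fixes f g :: "nat \<Rightarrow> 'a::{banach, second_countable_topology}"
  assumes "n \<ge> 2" "j \<in> {1..n}" "\<And>x. x \<in> {1..n} \<Longrightarrow> f x = g x"
  shows "measure_pmf.expectation (pos_law n j k) f = measure_pmf.expectation (pos_law n j k) g"
  using set_pos_law[OF assms(1,2), of k] assms(3)
  by (intro integral_cong_AE AE_pmfI) (simp, simp, blast)

section \<open>Bounds on the jump rates\<close>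

lemma up_rate_nonneg: "x \<in> {1..n} \<Longrightarrow> 0 \<le> up_rate n x"
  unfolding up_rate_def by (intro divide_nonneg_nonneg mult_nonneg_nonneg) auto

lemma up_rate_minus_down_rate:
  assumes "n \<ge> 2"
  shows "up_rate n x - down_rate n x = (real n + 1 - 2 * real x) / (real n * (real n - 1))"
  unfolding up_rate_def down_rate_def diff_divide_distrib[symmetric]
  by (simp add: algebra_simps)

text \<open>The numerator \<open>n + 1 - 2 x\<close> is largest in absolute value at the ends
  \<open>x = 1\<close> and \<open>x = n\<close>, where it equals \<open>n - 1\<close> up to
  sign.\<close>

lemma abs_drift_le:
  assumes "n \<ge> 2" "x \<in> {1..n}"
  shows "\<bar>up_rate n x - down_rate n x\<bar> \<le> 1 / real n"
proof -
  have "\<bar>up_rate n x - down_rate n x\<bar> = \<bar>real n + 1 - 2 * real x\<bar> / (real n * (real n - 1))"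
    using assms by (simp add: up_rate_minus_down_rate abs_mult)
  also have "\<dots> \<le> (real n - 1) / (real n * (real n - 1))"
    using assms by (intro divide_right_mono) auto
  also have "\<dots> = 1 / real n" using assms by simp
  finally show ?thesis .
qed

text \<open>The difference of the numerators factors as \<open>(x - j) * (n - x - j)\<close>. The
  second factor is at most \<open>n - 1\<close> in absolute value unless \<open>x = j = n\<close>,
  whence the case split.\<close>

lemma up_rate_lipschitz:
  assumes "n \<ge> 2" "x \<in> {1..n}" "j \<in> {1..n}"
  shows "\<bar>up_rate n x - up_rate n j\<bar> \<le> \<bar>real x - real j\<bar> / real n"
proof (cases "x = j")
  case False
  have "up_rate n x - up_rate n j = (real x - real j) * (real n - real x - real j) / (real n * (real n - 1))"
    unfolding up_rate_def diff_divide_distrib[symmetric] by (simp add: algebra_simps)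
  then have "\<bar>up_rate n x - up_rate n j\<bar>
      = \<bar>real x - real j\<bar> * \<bar>real n - real x - real j\<bar> / (real n * (real n - 1))"
    using assms by (simp add: abs_mult)
  also have "\<dots> \<le> \<bar>real x - real j\<bar> * (real n - 1) / (real n * (real n - 1))"
    using assms False by (intro divide_right_mono mult_left_mono) auto
  also have "\<dots> = \<bar>real x - real j\<bar> / real n" using assms by simp
  finally show ?thesis .
qed simp

text \<open>Lets the drift bound \<open>1 / n\<close> be absorbed into the jump rate at
  \<open>j\<close>.\<close>

lemma one_over_n_le_up_rate:
  assumes "1 \<le> j" "j < n"
  shows "1 / real n \<le> up_rate n j"
proof -
  have "(real j - 1) * (real n - 1 - real j) \<ge> 0"
    using assms by (intro mult_nonneg_nonneg) auto
  then have "real n - 1 \<le> real j * (real n - real j)"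
    by (simp add: algebra_simps)
  then have "(real n - 1) / (real n * (real n - 1)) \<le> up_rate n j"
    unfolding up_rate_def using assms by (intro divide_right_mono) auto
  then show ?thesis using assms by simp
qed

section \<open>First and second moments of the displacement\<close>

lemma pos_op_displacement:
  assumes "x \<ge> 1"
  shows "pos_op n (\<lambda>x. real x - real j) x = (real x - real j) + (up_rate n x - down_rate n x)"
  using assms by (simp add: pos_op_def of_nat_diff algebra_simps)

text \<open>An exact expansion around \<open>j\<close>, where \<open>b\<close> is the drift at
  \<open>j\<close> and \<open>2 * up_rate n j - b\<close> the total jump rate there. The linear term
  collects \<open>2 * b\<close> from the variation of the total rate and \<open>2 * b\<close> from
  the drift.\<close>

lemma pos_op_displacement_square:
  fixes n j x :: nat
  assumes "n \<ge> 2" "x \<ge> 1"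
  defines "b \<equiv> (real n + 1 - 2 * real j) / (real n * (real n - 1))"
  shows "pos_op n (\<lambda>x. (real x - real j)\<^sup>2) x = (real x - real j)\<^sup>2 + 2 * up_rate n j - b
    + 4 * b * (real x - real j) - 6 * (real x - real j)\<^sup>2 / (real n * (real n - 1))"
proof -
  define N where "N = real n * (real n - 1)"
  define y where "y = real x - real j"
  have N: "N \<noteq> 0" using assms by (simp add: N_def)
  have b: "N * b = real n + 1 - 2 * real j" using N by (simp add: b_def N_def)
  have up: "N * up_rate n z = real z * (real n - real z)"
    and down: "N * down_rate n z = (real z - 1) * (real n - real z + 1)" for z
    unfolding up_rate_def down_rate_def N_def[symmetric] using N by simp_all
  have x: "real x = real j + y" by (simp add: y_def)
  have "pos_op n (\<lambda>x. (real x - real j)\<^sup>2) x =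
      up_rate n x * (y + 1)\<^sup>2 + down_rate n x * (y - 1)\<^sup>2 + (1 - up_rate n x - down_rate n x) * y\<^sup>2"
    using assms(2) by (simp add: pos_op_def y_def of_nat_diff algebra_simps)
  also have "N * \<dots> = (N * up_rate n x) * (y + 1)\<^sup>2 + (N * down_rate n x) * (y - 1)\<^sup>2
      + (N - N * up_rate n x - N * down_rate n x) * y\<^sup>2"
    by (simp add: algebra_simps)
  also have "\<dots> = N * y\<^sup>2 + 2 * (N * up_rate n j) - N * b + 4 * (N * b) * y - 6 * y\<^sup>2"
    unfolding up down b x by (simp add: power2_eq_square algebra_simps)
  also have "\<dots> = N * (y\<^sup>2 + 2 * up_rate n j - b + 4 * b * y - 6 * y\<^sup>2 / N)"
    using N by (simp add: algebra_simps)
  finally show ?thesis using N by (simp add: N_def y_def)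
qed

text \<open>Each step adds a drift of at most \<open>1 / n\<close> in absolute value. This bound on
  the signed mean controls the linear term in the recursion for the second moment.\<close>

lemma mean_displacement_le:
  assumes "n \<ge> 2" "j \<in> {1..n}"
  shows "\<bar>measure_pmf.expectation (pos_law n j k) (\<lambda>x. real x - real j)\<bar> \<le> real k / real n"
proof (induction k)
  case 0
  show ?case using assms by (simp add: pos_law_0)
next
  case (Suc k)
  let ?E = "measure_pmf.expectation (pos_law n j k)"
  have "measure_pmf.expectation (pos_law n j (Suc k)) (\<lambda>x. real x - real j)
      = ?E (\<lambda>x. (real x - real j) + (up_rate n x - down_rate n x))"
    unfolding expectation_pos_law_Suc[OF assms]
    by (rule expectation_pos_law_cong[OF assms]) (rule pos_op_displacement, auto)
  also have "\<dots> = ?E (\<lambda>x. real x - real j) + ?E (\<lambda>x. up_rate n x - down_rate n x)"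
    by (intro Bochner_Integration.integral_add integrable_pos_law assms)
  finally have step: "measure_pmf.expectation (pos_law n j (Suc k)) (\<lambda>x. real x - real j)
      = ?E (\<lambda>x. real x - real j) + ?E (\<lambda>x. up_rate n x - down_rate n x)" .
  have "\<bar>?E (\<lambda>x. up_rate n x - down_rate n x)\<bar> \<le> ?E (\<lambda>x. \<bar>up_rate n x - down_rate n x\<bar>)"
    by (rule integral_abs_bound)
  also have "\<dots> \<le> ?E (\<lambda>x. 1 / real n)"
    by (intro expectation_pos_law_mono assms abs_drift_le)
  finally have "\<bar>?E (\<lambda>x. up_rate n x - down_rate n x)\<bar> \<le> 1 / real n" by simp
  with Suc step show ?case by (simp add: add_divide_distrib)
qed

text \<open>The linear term contributes at most \<open>4 * (1 / n) * (k / n)\<close> to step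
  \<open>k\<close>. Replacing \<open>k\<close> by the horizon \<open>T\<close> here makes all
  increments equal, so they sum to a multiple of \<open>k\<close>.\<close>

lemma square_displacement_le:
  assumes "n \<ge> 2" "j \<in> {1..n}" "k \<le> T"
  shows "measure_pmf.expectation (pos_law n j k) (\<lambda>x. (real x - real j)\<^sup>2)
      \<le> real k * (2 * up_rate n j + 1 / real n + 4 * real T / (real n)\<^sup>2)"
  using assms(3)
proof (induction k)
  case 0
  show ?case using assms by (simp add: pos_law_0)
next
  case (Suc k)
  let ?E = "measure_pmf.expectation (pos_law n j k)"
  define b where "b = (real n + 1 - 2 * real j) / (real n * (real n - 1))"
  have b: "\<bar>b\<bar> \<le> 1 / real n"
    using abs_drift_le[OF assms(1,2)] assms by (simp add: up_rate_minus_down_rate b_def)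
  have "measure_pmf.expectation (pos_law n j (Suc k)) (\<lambda>x. (real x - real j)\<^sup>2)
      = ?E (pos_op n (\<lambda>x. (real x - real j)\<^sup>2))"
    by (rule expectation_pos_law_Suc[OF assms(1,2)])
  \<comment> \<open>The quadratic term of the expansion enters with a negative sign and is
    dropped.\<close>
  also have "\<dots> \<le> ?E (\<lambda>x. (real x - real j)\<^sup>2 + ((2 * up_rate n j - b) + 4 * b * (real x - real j)))"
  proof (rule expectation_pos_law_mono[OF assms(1,2)])
    fix x assume "x \<in> {1..n}"
    moreover have "6 * (real x - real j)\<^sup>2 / (real n * (real n - 1)) \<ge> 0"
      using assms by (intro divide_nonneg_nonneg) auto
    ultimately show "pos_op n (\<lambda>x. (real x - real j)\<^sup>2) x
        \<le> (real x - real j)\<^sup>2 + ((2 * up_rate n j - b) + 4 * b * (real x - real j))"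
      using assms(1) by (subst pos_op_displacement_square) (auto simp: b_def)
  qed
  also have "\<dots> = ?E (\<lambda>x. (real x - real j)\<^sup>2)
      + ((2 * up_rate n j - b) + 4 * b * ?E (\<lambda>x. real x - real j))"
    using assms
    by (subst Bochner_Integration.integral_add, simp add: integrable_pos_law, simp add: integrable_pos_law,
        subst Bochner_Integration.integral_add, simp, simp add: integrable_pos_law) simp
  also have "\<dots> \<le> real k * (2 * up_rate n j + 1 / real n + 4 * real T / (real n)\<^sup>2)
      + ((2 * up_rate n j + 1 / real n) + 4 * (real T / (real n)\<^sup>2))"
  proof (intro add_mono)
    have "b * ?E (\<lambda>x. real x - real j) \<le> \<bar>b\<bar> * \<bar>?E (\<lambda>x. real x - real j)\<bar>"
      by (metis abs_ge_self abs_mult)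
    also have "\<dots> \<le> (1 / real n) * (real k / real n)"
      by (intro mult_mono b mean_displacement_le assms) auto
    also have "\<dots> \<le> real T / (real n)\<^sup>2"
      using Suc.prems by (simp add: power2_eq_square divide_right_mono)
    finally show "4 * b * ?E (\<lambda>x. real x - real j) \<le> 4 * (real T / (real n)\<^sup>2)" by simp
  qed (use Suc b in auto)
  finally show ?case by (simp add: algebra_simps add_divide_distrib)
qed

lemma abs_displacement_le:
  assumes "n \<ge> 2" "j \<in> {1..n}" "j < n" "k \<le> T"
  shows "measure_pmf.expectation (pos_law n j k) (\<lambda>x. \<bar>real x - real j\<bar>)
      \<le> sqrt (real T * (3 * up_rate n j + 4 * real T / (real n)\<^sup>2))"
proof (rule real_le_rsqrt)
  let ?E = "measure_pmf.expectation (pos_law n j k)"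
  \<comment> \<open>The square of a mean is at most the mean of the square, because the variance is
    nonnegative.\<close>
  have "(?E (\<lambda>x. \<bar>real x - real j\<bar>))\<^sup>2 \<le> ?E (\<lambda>x. \<bar>real x - real j\<bar>\<^sup>2)"
    using measure_pmf.variance_positive[of "pos_law n j k" "\<lambda>x. \<bar>real x - real j\<bar>"]
    unfolding measure_pmf.variance_eq[OF integrable_pos_law[OF assms(1,2)] integrable_pos_law[OF assms(1,2)]]
    by simp
  also have "\<dots> \<le> real k * (2 * up_rate n j + 1 / real n + 4 * real T / (real n)\<^sup>2)"
    using square_displacement_le[OF assms(1,2,4)] by simp
  also have "\<dots> \<le> real T * (3 * up_rate n j + 4 * real T / (real n)\<^sup>2)"
    using one_over_n_le_up_rate[of j n] up_rate_nonneg[of j n] assms by (intro mult_mono) auto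
  finally show "(?E (\<lambda>x. \<bar>real x - real j\<bar>))\<^sup>2
      \<le> real T * (3 * up_rate n j + 4 * real T / (real n)\<^sup>2)" .
qed

section \<open>Characteristic function of the displacement, for one step and for many\<close>

definition fourier_mult :: "nat \<Rightarrow> real \<Rightarrow> nat \<Rightarrow> complex" where
  "fourier_mult n a x = 1 + of_real (up_rate n x) * (iexp a - 1) + of_real (down_rate n x) * (iexp (- a) - 1)"

text \<open>A unit shift multiplies the exponential by \<open>iexp a\<close> or
  \<open>iexp (- a)\<close>, so exponentials would be eigenfunctions if the rates did not depend on
  \<open>x\<close>.\<close>

lemma pos_op_iexp:
  assumes "x \<ge> 1"
  shows "pos_op n (\<lambda>x. iexp (a * (real x - real j))) x
    = fourier_mult n a x * iexp (a * (real x - real j))"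
proof -
  define w where "w = iexp (a * (real x - real j))"
  have "iexp (a * (real (x + 1) - real j)) = w * iexp a"
    by (simp add: w_def exp_add[symmetric] algebra_simps)
  moreover have "iexp (a * (real (x - 1) - real j)) = w * iexp (- a)"
    using assms by (simp add: w_def exp_add[symmetric] algebra_simps of_nat_diff del: of_real_minus)
       (simp add: algebra_simps)
  ultimately show ?thesis
    unfolding pos_op_def fourier_mult_def w_def[symmetric]
    by (simp add: scaleR_conv_of_real algebra_simps)
qed

text \<open>The real part of the Taylor bound for \<open>iexp a\<close>, whose linear term is
  imaginary.\<close>

lemma cos_quadratic_approx: "\<bar>cos a - 1 + a\<^sup>2 / 2\<bar> \<le> \<bar>a\<bar> ^ 3 / (6::real)"
proof -
  have "Re (iexp a - (\<Sum>k\<le>2. (\<i> * of_real a) ^ k / fact k)) = cos a - 1 + a\<^sup>2 / 2"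
    by (simp add: numeral_2_eq_2 Re_exp power2_eq_square)
  then have "\<bar>cos a - 1 + a\<^sup>2 / 2\<bar> \<le> cmod (iexp a - (\<Sum>k\<le>2. (\<i> * of_real a) ^ k / fact k))"
    by (metis abs_Re_le_cmod)
  also have "\<dots> \<le> \<bar>a\<bar> ^ Suc 2 / fact (Suc 2)" by (rule iexp_approx1)
  finally show ?thesis by (simp add: fact_numeral eval_nat_numeral)
qed

text \<open>Follows from \<open>1 - z <= exp (- z) <= 1 / (1 + z) <= 1 - z + z^2\<close>.\<close>

lemma exp_minus_linear_approx:
  assumes "(z::real) \<ge> 0"
  shows "\<bar>1 - z - exp (- z)\<bar> \<le> z\<^sup>2"
proof -
  have "1 - z \<le> exp (- z)" using exp_ge_add_one_self[of "- z"] by simp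
  moreover have "exp (- z) \<le> 1 / (1 + z)"
    using exp_ge_add_one_self[of z] assms by (simp add: exp_minus field_simps)
  moreover have "1 / (1 + z) \<le> 1 - z + z\<^sup>2"
    using assms by (simp add: field_simps power2_eq_square)
  ultimately show ?thesis by simp
qed

lemma cmod_iexp_minus_one_le: "cmod (iexp a - 1) \<le> \<bar>a\<bar>"
  using iexp_approx1[of a 0] by simp

text \<open>The four error terms come from the Taylor expansion of the cosine, from replacing the
  local rate by \<open>lam\<close>, from replacing \<open>1 - lam * a^2\<close> by an exponential,
  and from the drift.\<close>

lemma fourier_mult_approx:
  assumes "n \<ge> 2" "x \<in> {1..n}" "lam \<ge> 0"
  shows "cmod (fourier_mult n a x - of_real (exp (- (lam * a\<^sup>2))))
    \<le> \<bar>a\<bar> ^ 3 * (lam + \<bar>up_rate n x - lam\<bar>) + a\<^sup>2 * \<bar>up_rate n x - lam\<bar> + (lam * a\<^sup>2)\<^sup>2 + \<bar>a\<bar> / real n"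
proof -
  define p where "p = up_rate n x"
  define d where "d = up_rate n x - down_rate n x"
  have p: "p \<ge> 0" using up_rate_nonneg assms by (simp add: p_def)
  have cubic: "2 * p * (\<bar>a\<bar> ^ 3 / 6) \<le> \<bar>a\<bar> ^ 3 * (lam + \<bar>p - lam\<bar>)"
  proof -
    have "2 * p / 6 \<le> lam + \<bar>p - lam\<bar>" using p by linarith
    then have "\<bar>a\<bar> ^ 3 * (2 * p / 6) \<le> \<bar>a\<bar> ^ 3 * (lam + \<bar>p - lam\<bar>)"
      by (intro mult_left_mono) auto
    then show ?thesis by (simp add: mult_ac)
  qed
  have cosine: "iexp a + iexp (- a) = of_real (2 * cos a)"
    by (simp add: complex_eq_iff Re_exp Im_exp)
  \<comment> \<open>Writing the down rate as \<open>p - d\<close> separates a symmetric walk, whose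
    multiplier is real, from the drift.\<close>
  have "fourier_mult n a x = 1 + of_real p * (iexp a + iexp (- a) - 2) - of_real d * (iexp (- a) - 1)"
    unfolding fourier_mult_def p_def d_def by (simp add: algebra_simps)
  then have "fourier_mult n a x - of_real (exp (- (lam * a\<^sup>2)))
     = of_real (2 * p * (cos a - 1 + a\<^sup>2 / 2) + a\<^sup>2 * (lam - p) + (1 - lam * a\<^sup>2 - exp (- (lam * a\<^sup>2))))
       - of_real d * (iexp (- a) - 1)"
    unfolding cosine by (simp add: algebra_simps)
  also have "cmod \<dots> \<le> \<bar>2 * p * (cos a - 1 + a\<^sup>2 / 2) + a\<^sup>2 * (lam - p) + (1 - lam * a\<^sup>2 - exp (- (lam * a\<^sup>2)))\<bar>
       + \<bar>d\<bar> * cmod (iexp (- a) - 1)"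
    by (rule order_trans[OF norm_triangle_ineq4]) (simp only: norm_mult norm_of_real order_refl)
  also have "\<dots> \<le> 2 * p * \<bar>cos a - 1 + a\<^sup>2 / 2\<bar> + a\<^sup>2 * \<bar>lam - p\<bar>
       + \<bar>1 - lam * a\<^sup>2 - exp (- (lam * a\<^sup>2))\<bar> + \<bar>d\<bar> * cmod (iexp (- a) - 1)"
  proof -
    have "\<bar>2 * p * (cos a - 1 + a\<^sup>2 / 2)\<bar> = 2 * p * \<bar>cos a - 1 + a\<^sup>2 / 2\<bar>"
      "\<bar>a\<^sup>2 * (lam - p)\<bar> = a\<^sup>2 * \<bar>lam - p\<bar>"
      using p by (simp_all add: abs_mult)
    then show ?thesis by linarith
  qed
  also have "\<dots> \<le> 2 * p * (\<bar>a\<bar> ^ 3 / 6) + a\<^sup>2 * \<bar>lam - p\<bar> + (lam * a\<^sup>2)\<^sup>2 + (1 / real n) * \<bar>- a\<bar>"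
    using p assms abs_drift_le[OF assms(1,2)]
    by (intro add_mono mult_mono mult_left_mono cos_quadratic_approx exp_minus_linear_approx
         cmod_iexp_minus_one_le) (auto simp: d_def)
  also have "\<dots> \<le> \<bar>a\<bar> ^ 3 * (lam + \<bar>p - lam\<bar>) + a\<^sup>2 * \<bar>p - lam\<bar> + (lam * a\<^sup>2)\<^sup>2 + \<bar>a\<bar> / real n"
    using cubic by (simp add: abs_minus_commute)
  finally show ?thesis by (simp add: p_def)
qed

text \<open>The one-step error is affine in the rate deviation, so a bound \<open>M\<close> on the
  mean displacement suffices and no pathwise control is needed. Because the factor
  \<open>exp (- (lam * a^2))\<close> is at most 1, the errors of the \<open>T\<close> steps simply
  add up.\<close>

lemma pos_law_char_approx:
  fixes n j T :: nat and a lam M :: real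
  assumes "n \<ge> 2" "j \<in> {1..n}" "lam \<ge> 0"
    and M: "\<And>k. k < T \<Longrightarrow> measure_pmf.expectation (pos_law n j k) (\<lambda>x. \<bar>real x - real j\<bar>) \<le> M"
  defines "\<delta> \<equiv> \<bar>up_rate n j - lam\<bar> + M / real n"
  shows "cmod (measure_pmf.expectation (pos_law n j T) (\<lambda>x. iexp (a * (real x - real j)))
      - of_real (exp (- (lam * a\<^sup>2)) ^ T))
    \<le> real T * (\<bar>a\<bar> ^ 3 * (lam + \<delta>) + a\<^sup>2 * \<delta> + (lam * a\<^sup>2)\<^sup>2 + \<bar>a\<bar> / real n)"
proof -
  let ?E = "\<lambda>k. measure_pmf.expectation (pos_law n j k)"
  define c where "c = exp (- (lam * a\<^sup>2))"
  define w where "w x = iexp (a * (real x - real j))" for x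
  define B where "B = \<bar>a\<bar> ^ 3 * (lam + \<delta>) + a\<^sup>2 * \<delta> + (lam * a\<^sup>2)\<^sup>2 + \<bar>a\<bar> / real n"
  have c: "0 \<le> c" "c \<le> 1" using assms by (auto simp: c_def)
  have step: "cmod (?E (Suc k) w - of_real c * ?E k w) \<le> B" if "k < T" for k
  proof -
    have "?E (Suc k) w = ?E k (\<lambda>x. fourier_mult n a x * w x)"
      unfolding expectation_pos_law_Suc[OF assms(1,2)] w_def
      by (rule expectation_pos_law_cong[OF assms(1,2)]) (rule pos_op_iexp, auto)
    then have "?E (Suc k) w - of_real c * ?E k w
        = ?E k (\<lambda>x. fourier_mult n a x * w x) - ?E k (\<lambda>x. of_real c * w x)"
      by simp
    also have "\<dots> = ?E k (\<lambda>x. fourier_mult n a x * w x - of_real c * w x)"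
      by (intro Bochner_Integration.integral_diff[symmetric] integrable_pos_law assms)
    also have "cmod \<dots> \<le> ?E k (\<lambda>x. cmod (fourier_mult n a x * w x - of_real c * w x))"
      by (rule integral_norm_bound)
    also have "\<dots> = ?E k (\<lambda>x. cmod (fourier_mult n a x - of_real c))"
      by (intro Bochner_Integration.integral_cong refl)
        (simp add: left_diff_distrib[symmetric] norm_mult w_def)
    \<comment> \<open>The pointwise bound is \<open>B\<close> plus a multiple of
      \<open>|x - j| - M\<close>, whose mean is at most 0 by the choice of \<open>M\<close>.\<close>
    also have "\<dots> \<le> ?E k (\<lambda>x. B + (\<bar>a\<bar> ^ 3 + a\<^sup>2) / real n * (\<bar>real x - real j\<bar> - M))"
    proof (rule expectation_pos_law_mono[OF assms(1,2)])
      fix x assume x: "x \<in> {1..n}"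
      have "\<bar>up_rate n x - lam\<bar> \<le> \<delta> + (\<bar>real x - real j\<bar> - M) / real n" (is "_ \<le> ?r")
        using up_rate_lipschitz[OF assms(1) x assms(2)] by (simp add: \<delta>_def diff_divide_distrib)
      then have "\<bar>a\<bar> ^ 3 * (lam + \<bar>up_rate n x - lam\<bar>) + a\<^sup>2 * \<bar>up_rate n x - lam\<bar> + (lam * a\<^sup>2)\<^sup>2 + \<bar>a\<bar> / real n
         \<le> \<bar>a\<bar> ^ 3 * (lam + ?r) + a\<^sup>2 * ?r + (lam * a\<^sup>2)\<^sup>2 + \<bar>a\<bar> / real n"
        by (intro add_mono mult_left_mono) auto
      also have "\<dots> = B + (\<bar>a\<bar> ^ 3 + a\<^sup>2) / real n * (\<bar>real x - real j\<bar> - M)"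
        unfolding B_def by (simp add: algebra_simps add_divide_distrib)
      finally show "cmod (fourier_mult n a x - of_real c) \<le> B + (\<bar>a\<bar> ^ 3 + a\<^sup>2) / real n * (\<bar>real x - real j\<bar> - M)"
        using fourier_mult_approx[OF assms(1) x assms(3), of a] by (simp add: c_def)
    qed
    also have "\<dots> = B + (\<bar>a\<bar> ^ 3 + a\<^sup>2) / real n * (?E k (\<lambda>x. \<bar>real x - real j\<bar>) - M)"
      using assms(1,2) by (simp add: integrable_pos_law)
    also have "\<dots> \<le> B"
    proof -
      have "(\<bar>a\<bar> ^ 3 + a\<^sup>2) / real n * (?E k (\<lambda>x. \<bar>real x - real j\<bar>) - M) \<le> 0"
        using M[OF that] by (intro mult_nonneg_nonpos) auto
      then show ?thesis by simp
    qed
    finally show ?thesis .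
  qed
  have "cmod (?E k w - of_real (c ^ k)) \<le> real k * B" if "k \<le> T" for k
    using that
  proof (induction k)
    case 0
    show ?case using assms by (simp add: pos_law_0 w_def)
  next
    case (Suc k)
    have "?E (Suc k) w - of_real (c ^ Suc k)
        = (?E (Suc k) w - of_real c * ?E k w) + of_real c * (?E k w - of_real (c ^ k))"
      by (simp add: algebra_simps)
    also have "cmod \<dots> \<le> B + c * (real k * B)"
      using step[of k] Suc c
      by (intro order_trans[OF norm_triangle_ineq] add_mono) (auto simp: norm_mult intro: mult_left_mono)
    also have "\<dots> \<le> B + 1 * (real k * B)"
    proof -
      \<comment> \<open>The induction hypothesis bounds a norm, so \<open>real k * B\<close> is
        nonnegative.\<close>
      have "cmod (?E k w - of_real (c ^ k)) \<le> real k * B" using Suc by simp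
      then have "real k * B \<ge> 0" using norm_ge_zero by (rule order_trans[rotated])
      then show ?thesis using c by (intro add_left_mono mult_right_mono) auto
    qed
    finally show ?case by (simp add: algebra_simps)
  qed
  from this[of T] show ?thesis by (simp add: B_def w_def[abs_def] c_def)
qed

text \<open>Expresses the accumulated error through \<open>r\<close>, \<open>e\<close>,
  \<open>1 / (T * lam)\<close> and \<open>1 / T\<close> alone; it becomes small when the first is
  near 1 and the others are near 0.\<close>

lemma pos_law_char_error:
  fixes n j T :: nat and lam u :: real
  assumes n: "n \<ge> 2" and j: "1 \<le> j" "j < n" and T: "T > 0" and lam: "lam > 0"
  defines "r \<equiv> up_rate n j / lam" and "e \<equiv> real T / ((real n)\<^sup>2 * lam)"
  defines "D \<equiv> \<bar>r - 1\<bar> + sqrt (3 * e * r + 4 * e\<^sup>2)"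
  shows "cmod (measure_pmf.expectation (pos_law n j T)
        (\<lambda>x. iexp (u * ((real x - real j) / sqrt (2 * real T * lam)))) - of_real (exp (- (u\<^sup>2) / 2)))
    \<le> u\<^sup>2 / 2 * (\<bar>u\<bar> * sqrt (1 / (real T * lam) / 2) * (1 + D) + D)
      + u ^ 4 / 4 * (1 / real T) + \<bar>u\<bar> * sqrt (e / 2)"
proof -
  define a where "a = u / sqrt (2 * real T * lam)"
  define M where "M = sqrt (real T * (3 * up_rate n j + 4 * real T / (real n)\<^sup>2))"
  define \<delta> where "\<delta> = \<bar>up_rate n j - lam\<bar> + M / real n"
  \<comment> \<open>The scaling \<open>a\<close> is made for this identity: the product of the
    \<open>T\<close> one-step factors is then exactly the normal characteristic function at
    \<open>u\<close>.\<close>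
  have a2: "real T * (lam * a\<^sup>2) = u\<^sup>2 / 2"
    using T lam by (simp add: a_def power_divide)
  then have la2: "lam * a\<^sup>2 = u\<^sup>2 / 2 / real T" using T by (simp add: field_simps)
  have abs_a: "\<bar>a\<bar> = \<bar>u\<bar> * sqrt (1 / (real T * lam) / 2)"
    using T lam by (simp add: a_def abs_mult real_sqrt_divide real_sqrt_mult field_simps)
  have delta: "\<delta> = lam * D"
  proof -
    have "\<bar>up_rate n j - lam\<bar> = lam * \<bar>r - 1\<bar>"
    proof -
      have "up_rate n j - lam = lam * (r - 1)" using lam by (simp add: r_def right_diff_distrib)
      then show ?thesis using lam by (simp add: abs_mult)
    qed
    moreover have "M / real n = lam * sqrt (3 * e * r + 4 * e\<^sup>2)"
    proof -
      have "real T * (3 * up_rate n j + 4 * real T / (real n)\<^sup>2)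
          = (real n * lam)\<^sup>2 * (3 * e * r + 4 * e\<^sup>2)"
        using n lam by (simp add: e_def r_def power2_eq_square field_simps)
      then have "M = real n * lam * sqrt (3 * e * r + 4 * e\<^sup>2)"
        using n lam by (simp add: M_def real_sqrt_mult)
      then show ?thesis using n by simp
    qed
    ultimately show ?thesis by (simp add: \<delta>_def D_def distrib_left)
  qed
  \<comment> \<open>This is the total contribution of the drift over \<open>T\<close> steps.\<close>
  have tail: "real T * (\<bar>a\<bar> / real n) = \<bar>u\<bar> * sqrt (e / 2)"
  proof -
    have "real T / real n * sqrt (1 / (real T * lam) / 2) = sqrt ((real T / real n)\<^sup>2 * (1 / (real T * lam) / 2))"
      by (simp only: real_sqrt_mult real_sqrt_abs) simp
    also have "(real T / real n)\<^sup>2 * (1 / (real T * lam) / 2) = e / 2"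
      using T n lam by (simp add: e_def power2_eq_square field_simps)
    finally have sqrt_e: "real T / real n * sqrt (1 / (real T * lam) / 2) = sqrt (e / 2)" .
    have "real T * (\<bar>a\<bar> / real n) = \<bar>u\<bar> * (real T / real n * sqrt (1 / (real T * lam) / 2))"
      unfolding abs_a by (simp only: times_divide_eq_left times_divide_eq_right mult_ac)
    then show ?thesis unfolding sqrt_e .
  qed
  have "cmod (measure_pmf.expectation (pos_law n j T) (\<lambda>x. iexp (a * (real x - real j)))
      - of_real (exp (- (lam * a\<^sup>2)) ^ T))
    \<le> real T * (\<bar>a\<bar> ^ 3 * (lam + \<delta>) + a\<^sup>2 * \<delta> + (lam * a\<^sup>2)\<^sup>2 + \<bar>a\<bar> / real n)"
    unfolding \<delta>_def M_def using n j lam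
    by (intro pos_law_char_approx abs_displacement_le) auto
  also have "exp (- (lam * a\<^sup>2)) ^ T = exp (- (u\<^sup>2) / 2)"
    using a2 by (simp add: exp_of_nat_mult[symmetric])
  also have "(\<lambda>x. iexp (a * (real x - real j))) = (\<lambda>x. iexp (u * ((real x - real j) / sqrt (2 * real T * lam))))"
    by (simp add: a_def)
  also have "real T * (\<bar>a\<bar> ^ 3 * (lam + \<delta>) + a\<^sup>2 * \<delta> + (lam * a\<^sup>2)\<^sup>2 + \<bar>a\<bar> / real n)
    = (real T * (lam * a\<^sup>2)) * (\<bar>a\<bar> * (1 + D) + D) + real T * (lam * a\<^sup>2)\<^sup>2 + real T * (\<bar>a\<bar> / real n)"
  proof -
    have "\<bar>a\<bar> ^ 3 = \<bar>a\<bar> * a\<^sup>2" by (simp add: power3_eq_cube power2_eq_square abs_mult_self_eq mult.assoc)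
    then show ?thesis unfolding delta by (simp add: algebra_simps)
  qed
  also have "real T * (lam * a\<^sup>2)\<^sup>2 = u ^ 4 / 4 * (1 / real T)"
    unfolding la2 using T by (simp add: power2_eq_square eval_nat_numeral)
  finally show ?thesis unfolding a2 tail unfolding abs_a .
qed

section \<open>Passage to the limit\<close>

lemma char_distr_measure_pmf:
  "char (distr (measure_pmf p) borel f) u = measure_pmf.expectation p (\<lambda>x. iexp (u * f x))"
  unfolding char_def by (subst integral_distr) auto

lemma real_distribution_distr_measure_pmf: "real_distribution (distr (measure_pmf p) borel f)"
  by (intro prob_space.real_distribution_distr measure_pmf.prob_space_axioms) simp

text \<open>A real \<open>pmf\<close> is a measure on all subsets, whereas the continuity theorem
  asks for Borel measures. Weak convergence looks only at distribution functions, and these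
  agree.\<close>

lemma cdf_map_pmf: "cdf (measure_pmf (map_pmf f p)) = cdf (distr (measure_pmf p) borel f)"
  by (simp add: fun_eq_iff cdf_def measure_map_pmf measure_distr)

lemma up_rate_eq:
  assumes "n \<ge> 2"
  shows "up_rate n x = (real x / real n) * (1 - real x / real n) * (real n / (real n - 1))"
  using assms by (simp add: up_rate_def field_simps)

text \<open>Division by zero yields 0, so both limits could hold through vanishing denominators;
  \<open>nondeg\<close> states that the denominators are eventually positive.\<close>

theorem theorem2:
  fixes j t :: "nat \<Rightarrow> nat" and \<gamma> :: real
  assumes j_range: "\<And>n. n \<ge> 1 \<Longrightarrow> j n \<in> {1..n}"
    and nondeg: "eventually (\<lambda>n. 0 < t n \<and> j n < n) sequentially"
    and gamma: "(\<lambda>n. real (j n) / real n) \<longlonglongrightarrow> \<gamma>"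
    and lim1: "(\<lambda>n. real n ^ 2 / (real (t n) * real (j n) * (real n - real (j n)))) \<longlonglongrightarrow> 0"
    and lim2: "(\<lambda>n. real (t n) / (real (j n) * (real n - real (j n)))) \<longlonglongrightarrow> 0"
  defines "lam \<equiv> (\<lambda>n. if \<gamma> = 0 then real (j n) / real n
                    else if \<gamma> = 1 then (real n - real (j n)) / real n
                    else \<gamma> * (1 - \<gamma>))"
  shows "weak_conv_m
           (\<lambda>n. measure_pmf (map_pmf
              (\<lambda>(\<sigma>, A). (real (\<sigma> (j n)) - real (j n)) / sqrt (2 * real (t n) * lam n))
              (cond_pmf (rtr n (t n)) {(\<sigma>, A). j n \<in> A})))
           std_normal_distribution"
proof -
  define F where "F n x = (real x - real (j n)) / sqrt (2 * real (t n) * lam n)" for n and x :: nat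
  \<comment> \<open>These are the quantities of \<open>pos_law_char_error\<close>; the task is to
    show that \<open>r\<close> tends to 1 and that \<open>e\<close>, \<open>g\<close> and
    \<open>1 / t n\<close> tend to 0.\<close>
  define r where "r n = up_rate n (j n) / lam n" for n
  define e where "e n = real (t n) / ((real n)\<^sup>2 * lam n)" for n
  define g where "g n = 1 / (real (t n) * lam n)" for n
  have good: "\<forall>\<^sub>F n in sequentially. n \<ge> 2 \<and> 1 \<le> j n \<and> j n < n \<and> 0 < t n"
    using nondeg eventually_ge_at_top[of 2] by eventually_elim (use j_range in force)
  have "\<forall>\<^sub>F n in sequentially. real (j n) / real n \<le> 1"
    using good by eventually_elim simp
  then have "\<gamma> \<le> 1"
    using gamma by (metis tendsto_upperbound sequentially_bot)
  moreover have "0 \<le> \<gamma>"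
    by (rule tendsto_lowerbound[OF gamma]) auto
  ultimately have inner: "\<gamma> * (1 - \<gamma>) > 0" if "\<gamma> \<noteq> 0" "\<gamma> \<noteq> 1"
    using that by (intro mult_pos_pos) auto
  have lam_pos: "\<forall>\<^sub>F n in sequentially. lam n > 0"
    using good by eventually_elim (use inner in \<open>auto simp: lam_def\<close>)
  have \<kappa>: "(\<lambda>n. real n / (real n - 1)) \<longlonglongrightarrow> 1" by real_asymp
  have \<kappa>': "(\<lambda>n. (real n - 1) / real n) \<longlonglongrightarrow> 1" by real_asymp
  \<comment> \<open>All three choices of \<open>lam\<close> are asymptotic to the jump rate
    \<open>v * (1 - v) * n / (n - 1)\<close> with \<open>v = j n / n\<close>: for a limit 0 or 1 the
    small factor cancels and the other tends to 1.\<close>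
  have r: "r \<longlonglongrightarrow> 1"
  proof -
    let ?v = "\<lambda>n. real (j n) / real n"
    consider "\<gamma> = 0" | "\<gamma> = 1" | "\<gamma> \<noteq> 0" "\<gamma> \<noteq> 1" by blast
    then show ?thesis
    proof cases
      case 1
      have "(\<lambda>n. (1 - ?v n) * (real n / (real n - 1))) \<longlonglongrightarrow> (1 - \<gamma>) * 1"
        by (intro tendsto_intros gamma \<kappa>)
      moreover have "\<forall>\<^sub>F n in sequentially. (1 - ?v n) * (real n / (real n - 1)) = r n"
        using good by eventually_elim (use 1 in \<open>simp add: r_def lam_def up_rate_eq\<close>)
      ultimately show ?thesis using 1 by (auto intro: Lim_transform_eventually)
    next
      case 2
      have "(\<lambda>n. ?v n * (real n / (real n - 1))) \<longlonglongrightarrow> \<gamma> * 1"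
        by (intro tendsto_intros gamma \<kappa>)
      moreover have "\<forall>\<^sub>F n in sequentially. ?v n * (real n / (real n - 1)) = r n"
        using good
      proof eventually_elim
        case (elim n)
        then have "lam n = 1 - ?v n" using 2 by (simp add: lam_def diff_divide_distrib)
        moreover have "1 - ?v n > 0" using elim by simp
        ultimately show ?case using elim by (simp add: r_def up_rate_eq)
      qed
      ultimately show ?thesis using 2 by (auto intro: Lim_transform_eventually)
    next
      case 3
      have "(\<lambda>n. ?v n * (1 - ?v n) * (real n / (real n - 1)) / (\<gamma> * (1 - \<gamma>)))
          \<longlonglongrightarrow> \<gamma> * (1 - \<gamma>) * 1 / (\<gamma> * (1 - \<gamma>))"
        using inner[OF 3] by (intro tendsto_intros gamma \<kappa>) auto
      moreover have "\<forall>\<^sub>F n in sequentially.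
          ?v n * (1 - ?v n) * (real n / (real n - 1)) / (\<gamma> * (1 - \<gamma>)) = r n"
        using good by eventually_elim (use 3 in \<open>simp add: r_def lam_def up_rate_eq\<close>)
      ultimately have "r \<longlonglongrightarrow> \<gamma> * (1 - \<gamma>) * 1 / (\<gamma> * (1 - \<gamma>))"
        by (rule Lim_transform_eventually)
      then show ?thesis using 3 by simp
    qed
  qed
  \<comment> \<open>Eliminating \<open>lam\<close> through \<open>r\<close> turns \<open>e\<close>
    into the sequence of \<open>lim2\<close>, and \<open>g\<close> below into that of
    \<open>lim1\<close>, up to factors tending to 1.\<close>
  have e: "e \<longlonglongrightarrow> 0"
  proof (rule Lim_transform_eventually)
    show "(\<lambda>n. r n * ((real n - 1) / real n) * (real (t n) / (real (j n) * (real n - real (j n))))) \<longlonglongrightarrow> 0"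
      by (rule tendsto_eq_intros r \<kappa>' lim2 refl)+ simp
    show "\<forall>\<^sub>F n in sequentially.
      r n * ((real n - 1) / real n) * (real (t n) / (real (j n) * (real n - real (j n)))) = e n"
      using good by eventually_elim (simp add: r_def e_def up_rate_def power2_eq_square)
  qed
  have g: "g \<longlonglongrightarrow> 0"
  proof (rule Lim_transform_eventually)
    show "(\<lambda>n. r n * ((real n - 1) / real n)
        * (real n ^ 2 / (real (t n) * real (j n) * (real n - real (j n))))) \<longlonglongrightarrow> 0"
      by (rule tendsto_eq_intros r \<kappa>' lim1 refl)+ simp
    show "\<forall>\<^sub>F n in sequentially. r n * ((real n - 1) / real n)
        * (real n ^ 2 / (real (t n) * real (j n) * (real n - real (j n)))) = g n"
      using good by eventually_elim (simp add: r_def g_def up_rate_def power2_eq_square)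
  qed
  \<comment> \<open>Since \<open>j * (n - j) <= n^2\<close>, the sequence of \<open>lim1\<close>
    dominates \<open>1 / t n\<close>.\<close>
  have t: "(\<lambda>n. 1 / real (t n)) \<longlonglongrightarrow> 0"
  proof (rule tendsto_sandwich[OF _ _ tendsto_const lim1])
    show "\<forall>\<^sub>F n in sequentially. 1 / real (t n)
        \<le> real n ^ 2 / (real (t n) * real (j n) * (real n - real (j n)))"
      using good
    proof eventually_elim
      case (elim n)
      have "real (j n) * (real n - real (j n)) \<le> real n * real n"
        using elim by (intro mult_mono) auto
      then have "(real n)\<^sup>2 / (real (t n) * (real n * real n))
          \<le> (real n)\<^sup>2 / (real (t n) * (real (j n) * (real n - real (j n))))"
        using elim by (intro divide_left_mono mult_left_mono mult_pos_pos) auto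
      then show ?case using elim by (simp add: power2_eq_square mult.assoc)
    qed
  qed auto
  have "weak_conv_m (\<lambda>n. distr (measure_pmf (pos_law n (j n) (t n))) borel (F n)) std_normal_distribution"
  proof (rule levy_continuity)
    fix u :: real
    let ?\<phi> = "\<lambda>n. measure_pmf.expectation (pos_law n (j n) (t n)) (\<lambda>x. iexp (u * F n x))"
    define d where "d = (\<lambda>n. \<bar>r n - 1\<bar> + sqrt (3 * e n * r n + 4 * (e n)\<^sup>2))"
    let ?B = "\<lambda>n. u\<^sup>2 / 2 * (\<bar>u\<bar> * sqrt (g n / 2) * (1 + d n) + d n)
      + u ^ 4 / 4 * (1 / real (t n)) + \<bar>u\<bar> * sqrt (e n / 2)"
    have d: "d \<longlonglongrightarrow> 0"
      unfolding d_def by (rule tendsto_eq_intros r e refl)+ simp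
    have "?B \<longlonglongrightarrow> u\<^sup>2 / 2 * (\<bar>u\<bar> * sqrt (0 / 2) * (1 + 0) + 0) + u ^ 4 / 4 * 0 + \<bar>u\<bar> * sqrt (0 / 2)"
      by (intro tendsto_intros d g e t) simp_all
    then have B: "?B \<longlonglongrightarrow> 0" by simp
    have "\<forall>\<^sub>F n in sequentially. norm (?\<phi> n - of_real (exp (- (u\<^sup>2) / 2))) \<le> ?B n"
      using good lam_pos
    proof eventually_elim
      case (elim n)
      then show ?case
        using pos_law_char_error[of n "j n" "t n" "lam n" u]
        by (simp only: F_def r_def e_def g_def d_def)
    qed
    then have "(\<lambda>n. ?\<phi> n - of_real (exp (- (u\<^sup>2) / 2))) \<longlonglongrightarrow> 0"
      by (rule Lim_null_comparison) (rule B)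
    then have "?\<phi> \<longlonglongrightarrow> of_real (exp (- (u\<^sup>2) / 2))"
      by (rule LIM_zero_cancel)
    then show "(\<lambda>n. char (distr (measure_pmf (pos_law n (j n) (t n))) borel (F n)) u)
        \<longlonglongrightarrow> char std_normal_distribution u"
      by (simp add: char_distr_measure_pmf char_std_normal_distribution)
  qed (rule real_distribution_distr_measure_pmf real_dist_normal_dist)+
  \<comment> \<open>The normalised displacement depends on the state only through the position of
    card \<open>j n\<close>, so its law is an image of \<open>pos_law\<close>.\<close>
  moreover have "map_pmf (\<lambda>(\<sigma>, A). (real (\<sigma> (j n)) - real (j n)) / sqrt (2 * real (t n) * lam n))
      (cond_pmf (rtr n (t n)) {(\<sigma>, A). j n \<in> A}) = map_pmf (F n) (pos_law n (j n) (t n))" for n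
    by (simp add: pos_law_def F_def map_pmf_comp case_prod_unfold)
  ultimately show ?thesis
    by (simp add: weak_conv_m_def cdf_map_pmf)
qed

end
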